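(* Let $k\ge 1$. Let $p_1,p_2$ be permutations of $\{1,\dots,k\}$ whose rightmost letter is $1$ (the least letter), such that $p_1$ avoids $1\text{-}23$ and $p_2$ avoids $1\text{-}32$. (Thus the complements $C(p_1),C(p_2)$ have $k$ as their rightmost letter, $C(p_1)$ avoids $3\text{-}21$, and $C(p_2)$ avoids $3\text{-}12$.) Then $$E^{p_1}_{1\text{-}23}(x)=E^{C(p_1)}_{3\text{-}21}(x)=E^{p_2}_{1\text{-}32}(x)=E^{C(p_2)}_{3\text{-}12}(x)=\begin{cases}\dfrac{e^{e^x}}{(k-1)!}\displaystyle\int_0^x t^{k-1}e^{-e^t+t}\,dt,&\text{if }k\ge2,\\[2mm] e^{e^x-1},&\text{if }k=1.\end{cases}$$
   Context: For a permutation $abc$ of $\{1,2,3\}$, a permutation $\pi=\pi_1\cdots\pi_n$ of $\{1,\dots,n\}$ contains the generalized pattern $a\text{-}bc$ if there are indices $i<j<n$ such that $\pi_i\pi_j\pi_{j+1}$ is order-isomorphic to $abc$ (the last two letters must be adjacent in $\pi$); otherwise it avoids it. A permutation $\pi$ begins with a pattern $p=p_1\cdots p_k$ if $n\ge k$ and $\pi_1\cdots\pi_k$ is order-isomorphic to $p$; by convention, the empty permutation is also regarded as beginning with the pattern $1$ (the case $k=1$). The complement $C(\sigma)$ of $\sigma=\sigma_1\cdots\sigma_m$ is $b_1\cdots b_m$ with $b_i=m+1-\sigma_i$. $E^p_q(x)=\sum_{n\ge0}N^p_q(n)\frac{x^n}{n!}$, where $N^p_q(n)$ is the number of permutations of $\{1,\dots,n\}$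 that avoid $q$ and begin with $p$. Identities are identities of power series in $x$. *)

theory Defs
  imports
    "HOL-Analysis.Analysis"
    "HOL-Combinatorics.Multiset_Permutations"
begin

text \<open>
  A permutation of \<open>{1,\<dots>,n}\<close> is represented by its one-line notation, i.e. by an element
  of \<^term>\<open>permutations_of_set {1..n}\<close>. Since lists are indexed from \<open>0\<close>, the \<open>i\<close>-th letter
  of \<open>\<pi>\<close> is \<open>\<pi> ! (i - 1)\<close>.
\<close>

definition order_isomorphic :: "nat list \<Rightarrow> nat list \<Rightarrow> bool" where
  "order_isomorphic xs ys \<longleftrightarrow>
     length xs = length ys \<and>
     (\<forall>i<length xs. \<forall>j<length xs. xs ! i < xs ! j \<longleftrightarrow> ys ! i < ys ! j)"

text \<open>
  The list \<open>q = [a, b, c]\<close> stands for the generalized pattern \<open>a-bc\<close>: the letters playing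
  the roles of \<open>b\<close> and \<open>c\<close> have to be adjacent.
\<close>

definition contains_gpattern :: "nat list \<Rightarrow> nat list \<Rightarrow> bool" where
  "contains_gpattern \<pi> q \<longleftrightarrow>
     (\<exists>i j. i < j \<and> j + 1 < length \<pi> \<and> order_isomorphic [\<pi> ! i, \<pi> ! j, \<pi> ! (j + 1)] q)"

definition avoids_gpattern :: "nat list \<Rightarrow> nat list \<Rightarrow> bool" where
  "avoids_gpattern \<pi> q \<longleftrightarrow> \<not> contains_gpattern \<pi> q"

text \<open>By convention, the empty permutation also begins with the pattern \<open>1\<close>.\<close>

definition begins_with :: "nat list \<Rightarrow> nat list \<Rightarrow> bool" where
  "begins_with \<pi> p \<longleftrightarrow>
     (length p \<le> length \<pi> \<and> order_isomorphic (take (length p) \<pi>) p) \<or> (\<pi> = [] \<and> p = [1])"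

definition perm_complement :: "nat list \<Rightarrow> nat list" where
  "perm_complement \<sigma> = map (\<lambda>s. length \<sigma> + 1 - s) \<sigma>"

definition num_avoiding :: "nat list \<Rightarrow> nat list \<Rightarrow> nat \<Rightarrow> nat" where
  "num_avoiding p q n =
     card {\<pi> \<in> permutations_of_set {1..n}. avoids_gpattern \<pi> q \<and> begins_with \<pi> p}"

definition egf_avoiding :: "nat list \<Rightarrow> nat list \<Rightarrow> real fps" where
  "egf_avoiding p q = Abs_fps (\<lambda>n. real (num_avoiding p q n) / fact n)"

end

(* Split a permutation at its least letter m as s m t. It avoids 1-23 (resp. 1-32) iff s does and t
   is decreasing (resp. increasing), so t is determined by s; and since p ends in its least letter,
   it begins with p iff s does or s m is itself order isomorphic to p. This gives
   N(n+1) = sum_i C(n,i) N(i) + [k >= 2] C(n,k-1), that is, for the exponential generating function,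
   E' = e^x (E + [k >= 2] x^(k-1)/(k-1)!), a linear differential equation. Complementation reduces
   3-21 and 3-12 to these two patterns. *)

theory Submission
  imports Defs
begin

section \<open>Order isomorphism and its effect on patterns\<close>

lemma order_isomorphic_sym: "order_isomorphic xs ys \<Longrightarrow> order_isomorphic ys xs"
  by (auto simp: order_isomorphic_def)

lemma order_isomorphic_trans:
  "order_isomorphic xs ys \<Longrightarrow> order_isomorphic ys zs \<Longrightarrow> order_isomorphic xs zs"
  by (auto simp: order_isomorphic_def)

lemma order_isomorphic_length: "order_isomorphic xs ys \<Longrightarrow> length xs = length ys"
  by (simp add: order_isomorphic_def)

lemma order_isomorphic_take: "order_isomorphic xs ys \<Longrightarrow> order_isomorphic (take n xs) (take n ys)"
  by (auto simp: order_isomorphic_def)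

lemma order_isomorphic_cong_left:
  "order_isomorphic xs ys \<Longrightarrow> order_isomorphic xs zs \<longleftrightarrow> order_isomorphic ys zs"
  by (meson order_isomorphic_sym order_isomorphic_trans)

lemma order_isomorphic_map:
  assumes "strict_mono_on S f" "set xs \<subseteq> S"
  shows "order_isomorphic (map f xs) xs"
proof -
  have "f (xs ! i) < f (xs ! j) \<longleftrightarrow> xs ! i < xs ! j" if "i < length xs" "j < length xs" for i j
    using strict_mono_on_less[OF assms(1), of "xs ! i" "xs ! j"] that assms(2)
    by (meson nth_mem subsetD)
  then show ?thesis by (auto simp: order_isomorphic_def)
qed

lemma order_isomorphic_3:
  "order_isomorphic [x, y, z] [a, b, c] \<longleftrightarrow>
     (x < y \<longleftrightarrow> a < b) \<and> (y < x \<longleftrightarrow> b < a) \<and> (x < z \<longleftrightarrow> a < c) \<and> (z < x \<longleftrightarrow> c < a) \<and>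
     (y < z \<longleftrightarrow> b < c) \<and> (z < y \<longleftrightarrow> c < b)"
  unfolding order_isomorphic_def
  by (simp add: All_less_Suc2) blast

lemma contains_gpattern_cong:
  assumes "order_isomorphic xs ys"
  shows "contains_gpattern xs q \<longleftrightarrow> contains_gpattern ys q"
proof -
  have "order_isomorphic [xs ! i, xs ! j, xs ! (j + 1)] q \<longleftrightarrow>
      order_isomorphic [ys ! i, ys ! j, ys ! (j + 1)] q"
    if "i < j" "j + 1 < length xs" for i j
  proof (rule order_isomorphic_cong_left)
    show "order_isomorphic [xs ! i, xs ! j, xs ! (j + 1)] [ys ! i, ys ! j, ys ! (j + 1)]"
      using assms that unfolding order_isomorphic_3 by (auto simp: order_isomorphic_def)
  qed
  then have "i < j \<and> j + 1 < length xs \<and> order_isomorphic [xs ! i, xs ! j, xs ! (j + 1)] q \<longleftrightarrow>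
      i < j \<and> j + 1 < length ys \<and> order_isomorphic [ys ! i, ys ! j, ys ! (j + 1)] q" for i j
    using order_isomorphic_length[OF assms] by auto
  then show ?thesis unfolding contains_gpattern_def by simp
qed

lemma begins_with_cong:
  assumes "order_isomorphic xs ys"
  shows "begins_with xs p \<longleftrightarrow> begins_with ys p"
  using order_isomorphic_cong_left[OF order_isomorphic_take[OF assms]]
    order_isomorphic_length[OF assms]
  by (auto simp: begins_with_def)

text \<open>In a word without repetitions, the number of letters below a given one can be read off
  from the comparisons between positions, so it agrees in \<open>xs\<close> and \<open>ys\<close>.
  Over a fixed set of letters this rank determines the letter.\<close>

lemma order_isomorphic_unique:
  assumes iso: "order_isomorphic xs ys" and "distinct xs" "distinct ys" "set xs = set ys"
  shows "xs = ys"
proof (rule nth_equalityI)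
  show len: "length xs = length ys" using iso by (rule order_isomorphic_length)
  fix i assume i: "i < length xs"
  have rank: "card {a \<in> set zs. a < zs ! i} = card {j. j < length zs \<and> zs ! j < zs ! i}"
    if "distinct zs" for zs :: "nat list"
  proof -
    have "{a \<in> set zs. a < zs ! i} = (!) zs ` {j. j < length zs \<and> zs ! j < zs ! i}"
      by (auto simp: in_set_conv_nth)
    moreover have "inj_on ((!) zs) {j. j < length zs \<and> zs ! j < zs ! i}"
      using that by (auto simp: inj_on_def nth_eq_iff_index_eq)
    ultimately show ?thesis by (simp add: card_image)
  qed
  have "{j. j < length xs \<and> xs ! j < xs ! i} = {j. j < length ys \<and> ys ! j < ys ! i}"
    using iso i by (auto simp: order_isomorphic_def)
  then have eq: "card {a \<in> set xs. a < xs ! i} = card {a \<in> set xs. a < ys ! i}"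
    using rank[OF assms(2)] rank[OF assms(3)] assms(4) by simp
  \<comment> \<open>The inequality is strict because of \<open>u\<close> itself, which is counted
    only on the right.\<close>
  have less: "card {a \<in> set xs. a < u} < card {a \<in> set xs. a < v}" if "u \<in> set xs" "u < v" for u v
    using that by (intro psubset_card_mono) auto
  have "xs ! i \<in> set xs" using i by simp
  moreover have "ys ! i \<in> set xs" unfolding assms(4) using i len by simp
  ultimately show "xs ! i = ys ! i"
    using less[of "xs ! i" "ys ! i"] less[of "ys ! i" "xs ! i"] eq by linarith
qed

section \<open>Counting over an arbitrary set of letters\<close>

text \<open>Arbitrary sets of letters are allowed because the word before the least letter may use
  any subset of the remaining letters.\<close>

definition avoiding_perms :: "nat list \<Rightarrow> nat list \<Rightarrow> nat set \<Rightarrow> nat list set" where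
  "avoiding_perms p q A = {\<pi> \<in> permutations_of_set A. avoids_gpattern \<pi> q \<and> begins_with \<pi> p}"

lemma obtain_relabelling:
  fixes A :: "nat set"
  assumes "finite A"
  obtains f where "bij_betw f {1..card A} A" "strict_mono_on {1..card A} f"
proof -
  obtain h where h: "bij_betw h {..<card A} A" "strict_mono_on {..<card A} h"
    using ex_bij_betw_strict_mono_card[OF assms] by blast
  have "bij_betw (\<lambda>i. i - 1) {1..card A} {..<card A}"
    by (rule bij_betwI[where g = Suc]) auto
  then have "bij_betw (\<lambda>i. h (i - 1)) {1..card A} A"
    using bij_betw_trans[OF _ h(1)] by (fastforce simp: o_def)
  moreover have "strict_mono_on {1..card A} (\<lambda>i. h (i - 1))"
    by (auto simp: strict_mono_on_def intro!: strict_mono_onD[OF h(2)])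
  ultimately show ?thesis by (rule that)
qed

text \<open>The increasing bijection from \<open>{1..card A}\<close> to \<open>A\<close>, applied
  letter by letter, preserves all comparisons, hence both conditions.\<close>

lemma card_avoiding_perms:
  assumes "finite A"
  shows "card (avoiding_perms p q A) = num_avoiding p q (card A)"
proof -
  obtain f where f: "bij_betw f {1..card A} A" and mono: "strict_mono_on {1..card A} f"
    using obtain_relabelling[OF assms] .
  have iso: "order_isomorphic (map f \<pi>) \<pi>" if "\<pi> \<in> permutations_of_set {1..card A}" for \<pi>
    using order_isomorphic_map[OF mono] that by (simp add: permutations_of_set_def)
  have "permutations_of_set A = map f ` permutations_of_set {1..card A}"
    using f permutations_of_set_image_inj[of f "{1..card A}"] by (simp add: bij_betw_def)
  then have "avoiding_perms p q A = map f ` avoiding_perms p q {1..card A}"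
    using contains_gpattern_cong[OF iso] begins_with_cong[OF iso]
    by (auto simp: avoiding_perms_def avoids_gpattern_def)
  moreover have "inj_on (map f) (avoiding_perms p q {1..card A})"
    using f unfolding bij_betw_def avoiding_perms_def
    by (intro inj_on_mapI) (auto simp: permutations_of_set_def elim!: inj_on_subset)
  ultimately show ?thesis
    by (simp add: card_image num_avoiding_def avoiding_perms_def)
qed

text \<open>Existence comes from relabelling \<open>p\<close> increasingly by the elements of
  \<open>A\<close>; two such words are order isomorphic to each other over the same letters, hence
  equal.\<close>

lemma ex1_order_isomorphic_perm:
  assumes p: "p \<in> permutations_of_set {1..k}" and A: "finite A" "card A = k"
  shows "\<exists>!\<pi>. \<pi> \<in> permutations_of_set A \<and> order_isomorphic \<pi> p"
proof (rule ex_ex1I)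
  obtain f where f: "bij_betw f {1..k} A" "strict_mono_on {1..k} f"
    using obtain_relabelling[OF A(1)] A(2) by blast
  have "map f p \<in> permutations_of_set A"
    using permutations_of_set_image_inj[of f "{1..k}"] f(1) p by (auto simp: bij_betw_def)
  moreover have "order_isomorphic (map f p) p"
    using order_isomorphic_map[OF f(2)] p by (simp add: permutations_of_set_def)
  ultimately show "\<exists>\<pi>. \<pi> \<in> permutations_of_set A \<and> order_isomorphic \<pi> p" by blast
next
  fix \<pi> \<pi>' assume "\<pi> \<in> permutations_of_set A \<and> order_isomorphic \<pi> p"
    "\<pi>' \<in> permutations_of_set A \<and> order_isomorphic \<pi>' p"
  then show "\<pi> = \<pi>'"
    using order_isomorphic_unique[of \<pi> \<pi>']
    by (metis order_isomorphic_sym order_isomorphic_trans permutations_of_setD)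
qed

section \<open>Beginning with a pattern that ends in its least letter\<close>

text \<open>If the first \<open>k\<close> letters reached beyond \<open>m\<close>, the least of them
  would not be the last, whereas \<open>p\<close> has its least letter at the end. So they lie
  within \<open>s\<close> or end exactly at \<open>m\<close>.\<close>

lemma begins_with_append_least:
  assumes p: "p \<in> permutations_of_set {1..k}" "last p = 1" "k \<ge> 1"
    and m: "\<forall>x \<in> set s \<union> set t. m < x"
  shows "begins_with (s @ m # t) p \<longleftrightarrow>
    k \<le> length s \<and> order_isomorphic (take k s) p \<or>
    length s + 1 = k \<and> order_isomorphic (s @ [m]) p"
proof -
  have len: "length p = k" and dist: "distinct p" and setp: "set p = {1..k}"
    using p length_finite_permutations_of_set[OF p(1)] by (auto simp: permutations_of_set_def)
  have lastp: "p ! (k - 1) = 1" using p len by (metis last_conv_nth length_0_conv not_one_le_zero)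
  have "\<not> order_isomorphic (take k (s @ m # t)) p"
    if short: "length s + 1 < k" and long: "k \<le> length (s @ m # t)"
  proof
    let ?xs = "take k (s @ m # t)"
    assume iso: "order_isomorphic ?xs p"
    \<comment> \<open>Position \<open>length s\<close> is not the final one of \<open>p\<close>, so
      its letter exceeds the final letter 1; in \<open>?xs\<close> the letter there is
      \<open>m\<close>, and no letter is smaller.\<close>
    have "p ! length s \<noteq> p ! (k - 1)" using short dist len by (simp add: nth_eq_iff_index_eq)
    moreover have "p ! length s \<in> set p" using short len by simp
    ultimately have "p ! (k - 1) < p ! length s" using setp lastp by auto
    then have "?xs ! (k - 1) < ?xs ! length s"
      using iso short len by (auto simp: order_isomorphic_def)
    moreover have "\<not> k - Suc 0 < length s" using short by linarith
    then have "?xs ! (k - 1) = t ! (k - 1 - length s - 1)" "?xs ! length s = m"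
      using short by (simp_all add: nth_append nth_Cons')
    ultimately have "t ! (k - 1 - length s - 1) < m" by simp
    moreover have "t ! (k - 1 - length s - 1) \<in> set t" using short long by (intro nth_mem) auto
    ultimately show False using m by (meson UnI2 not_less_iff_gr_or_eq)
  qed
  then show ?thesis unfolding begins_with_def len
    by (cases "length s + 1" k rule: linorder_cases) auto
qed

text \<open>The bound \<open>length p \<ge> 2\<close> is there because, by convention, the empty
  permutation begins with \<open>[1]\<close>; otherwise a permutation shorter than \<open>p\<close>
  cannot begin with it.\<close>

lemma num_avoiding_eq_0:
  assumes "n < length p" "length p \<ge> 2"
  shows "num_avoiding p q n = 0"
proof -
  have "\<not> begins_with \<pi> p" if "\<pi> \<in> permutations_of_set {1..n}" for \<pi>
    using assms length_finite_permutations_of_set[OF that] by (auto simp: begins_with_def)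
  then have "{\<pi> \<in> permutations_of_set {1..n}. avoids_gpattern \<pi> q \<and> begins_with \<pi> p} = {}"
    by blast
  then show ?thesis unfolding num_avoiding_def by (simp only: card.empty)
qed

text \<open>Initial value for both the recursion and the differential equation; the value 1 for
  \<open>k = 1\<close> reflects the convention on the empty permutation.\<close>

lemma num_avoiding_at_0:
  assumes "p \<in> permutations_of_set {1..k}" "k \<ge> 1"
  shows "num_avoiding p q 0 = (if k \<ge> 2 then 0 else 1)"
proof (cases "k \<ge> 2")
  case True
  then show ?thesis
    using num_avoiding_eq_0[of 0 p] length_finite_permutations_of_set[OF assms(1)] by simp
next
  case False
  then have "k = 1" using assms(2) by simp
  then have p: "p = [1]" using assms(1) by (simp add: permutations_of_set_singleton)
  have "{\<pi> \<in> permutations_of_set {1..0}. avoids_gpattern \<pi> q \<and> begins_with \<pi> [1]} = {[]}"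
    by (auto simp: avoids_gpattern_def contains_gpattern_def begins_with_def)
  then show ?thesis using False unfolding num_avoiding_def p by simp
qed

section \<open>Splitting an avoiding permutation at its least letter\<close>

text \<open>\<open>R\<close> is the order in which the letters following the least one must appear.\<close>

locale least_gpattern =
  fixes q :: "nat list" and R :: "nat \<Rightarrow> nat \<Rightarrow> bool"
  assumes pattern: "q = [1, 2, 3] \<and> R = (\<ge>) \<or> q = [1, 3, 2] \<and> R = (\<le>)"
begin

text \<open>Both patterns start with their least letter and differ only in the order of the adjacent
  pair, which in either case is the one that \<open>R\<close> forbids.\<close>

lemma contains_gpattern_iff:
  assumes "distinct \<pi>"
  shows "contains_gpattern \<pi> q \<longleftrightarrow>
    (\<exists>i j. i < j \<and> j + 1 < length \<pi> \<and> \<pi> ! i < \<pi> ! j \<and> \<pi> ! i < \<pi> ! (j + 1) \<and>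
           \<not> R (\<pi> ! j) (\<pi> ! (j + 1)))"
proof -
  have iff: "order_isomorphic [x, y, z] q \<longleftrightarrow> x < y \<and> x < z \<and> \<not> R y z" if "y \<noteq> z" for x y z
    using that pattern by (elim disjE) (auto simp: order_isomorphic_3)
  have "\<pi> ! j \<noteq> \<pi> ! (j + 1)" if "j + 1 < length \<pi>" for j
    using that assms by (simp add: nth_eq_iff_index_eq)
  then show ?thesis unfolding contains_gpattern_def by (metis iff)
qed

text \<open>The least letter cannot belong to the adjacent pair of an occurrence, so the pair lies
  wholly in \<open>s\<close> or wholly in \<open>t\<close>. A pair in \<open>t\<close> always has
  the smaller letter \<open>m\<close> before it, so every adjacent pair of \<open>t\<close> must
  respect \<open>R\<close>.\<close>

lemma avoids_append_least:
  assumes "distinct (s @ m # t)" and m: "\<forall>x \<in> set s \<union> set t. m < x"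
  shows "avoids_gpattern (s @ m # t) q \<longleftrightarrow> avoids_gpattern s q \<and> sorted_wrt R t"
proof -
  let ?\<pi> = "s @ m # t" and ?n = "length s"
  have ge: "m \<le> ?\<pi> ! i" if "i < length ?\<pi>" for i
    using m nth_mem[OF that] by (auto simp del: nth_mem intro: less_imp_le)
  have tl: "?\<pi> ! (?n + 1 + j) = t ! j" for j by (simp add: nth_append)
  \<comment> \<open>Transitivity reduces sortedness to adjacent pairs, the only ones that the
    pattern sees.\<close>
  have "transp R" using pattern by (auto simp: transp_def)
  then have sorted: "sorted_wrt R t \<longleftrightarrow> (\<forall>j. j + 1 < length t \<longrightarrow> R (t ! j) (t ! (j + 1)))"
    by (simp add: sorted_wrt_iff_nth_Suc_transp)
  have "contains_gpattern ?\<pi> q \<longleftrightarrow> contains_gpattern s q \<or> \<not> sorted_wrt R t"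
  proof
    assume "contains_gpattern ?\<pi> q"
    then obtain i j where ij: "i < j" "j + 1 < length ?\<pi>" "?\<pi> ! i < ?\<pi> ! j" "?\<pi> ! i < ?\<pi> ! (j + 1)"
      "\<not> R (?\<pi> ! j) (?\<pi> ! (j + 1))"
      using contains_gpattern_iff[OF assms(1)] by blast
    \<comment> \<open>If \<open>m\<close> belonged to the adjacent pair, it would exceed
      \<open>?\<pi> ! i\<close>, although it is least.\<close>
    have "j \<noteq> ?n" "j + 1 \<noteq> ?n" using ij ge[of i] by auto
    then consider "j + 1 < ?n" | "?n < j" by linarith
    then show "contains_gpattern s q \<or> \<not> sorted_wrt R t"
    proof cases
      case 1
      have s: "distinct s" using assms(1) by simp
      have "contains_gpattern s q" unfolding contains_gpattern_iff[OF s]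
        using ij 1 by (intro exI[of _ i] exI[of _ j]) (simp add: nth_append)
      then show ?thesis ..
    next
      case 2
      then obtain j' where "j = ?n + 1 + j'" by (metis Suc_eq_plus1 less_iff_Suc_add add_Suc)
      then have "\<not> R (t ! j') (t ! (j' + 1))" "j' + 1 < length t" using ij(5,2) tl[of j'] tl[of "j' + 1"]
        by (simp_all add: add.assoc)
      then show ?thesis using sorted by blast
    qed
  next
    assume "contains_gpattern s q \<or> \<not> sorted_wrt R t"
    then show "contains_gpattern ?\<pi> q"
    proof
      assume "contains_gpattern s q"
      then obtain i j where "i < j" "j + 1 < length s" "s ! i < s ! j" "s ! i < s ! (j + 1)"
        "\<not> R (s ! j) (s ! (j + 1))"
        using contains_gpattern_iff[of s] assms(1) by (metis distinct_append)
      then show ?thesis unfolding contains_gpattern_iff[OF assms(1)]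
        by (intro exI[of _ i] exI[of _ j]) (auto simp: nth_append)
    next
      assume "\<not> sorted_wrt R t"
      then obtain j where j: "j + 1 < length t" "\<not> R (t ! j) (t ! (j + 1))" using sorted by blast
      have "t ! j \<in> set t" "t ! (j + 1) \<in> set t" using j by auto
      then have "m < t ! j" "m < t ! (j + 1)" using m by auto
      \<comment> \<open>The first letter of the occurrence is \<open>m\<close> itself, at position
        \<open>?n\<close>.\<close>
      then show ?thesis unfolding contains_gpattern_iff[OF assms(1)]
        using j tl[of j] tl[of "j + 1"]
        by (intro exI[of _ ?n] exI[of _ "?n + 1 + j"]) (auto simp: add.assoc)
    qed
  qed
  then show ?thesis by (simp add: avoids_gpattern_def)
qed

text \<open>For finite \<open>X\<close> this is the only arrangement of its letters sorted by
  \<open>R\<close>: decreasing for \<open>1-23\<close>, increasing for \<open>1-32\<close>.\<close>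

definition arrange :: "nat set \<Rightarrow> nat list" where
  "arrange X = (if q = [1, 2, 3] then rev (sorted_list_of_set X) else sorted_list_of_set X)"

lemma arrange:
  assumes "finite X"
  shows "set (arrange X) = X" "distinct (arrange X)" "sorted_wrt R (arrange X)"
proof -
  show "set (arrange X) = X" "distinct (arrange X)" using assms by (simp_all add: arrange_def)
  have "sorted_wrt (\<ge>) (rev (sorted_list_of_set X))" by (simp add: sorted_wrt_rev)
  then show "sorted_wrt R (arrange X)"
    using pattern unfolding arrange_def by (elim disjE conjE) simp_all
qed

lemma arrange_unique:
  assumes "distinct t" "sorted_wrt R t"
  shows "t = arrange (set t)"
proof (cases "q = [1, 2, 3]")
  case True
  then have "sorted (rev t)" using assms pattern by (auto simp: sorted_wrt_rev)
  then have "rev t = sorted_list_of_set (set t)"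
    using assms by (metis sorted_list_of_set.idem_if_sorted_distinct distinct_rev set_rev)
  then show ?thesis using True by (metis arrange_def rev_rev_ident)
next
  case False
  then have "sorted t" using assms(2) pattern by auto
  then show ?thesis using False assms(1)
    by (simp add: arrange_def sorted_list_of_set.idem_if_sorted_distinct)
qed

text \<open>The words that may precede the least letter \<open>m\<close>.\<close>

definition prefixes :: "nat list \<Rightarrow> nat \<Rightarrow> nat set \<Rightarrow> nat list set" where
  "prefixes p m S = {s \<in> permutations_of_set S. avoids_gpattern s q \<and>
     (length p \<le> length s \<and> order_isomorphic (take (length p) s) p \<or>
      length s + 1 = length p \<and> order_isomorphic (s @ [m]) p)}"

text \<open>The letters after \<open>m\<close> must be sorted by \<open>R\<close>, so
  \<open>s\<close> and \<open>B\<close> determine them; conversely, every admissible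
  \<open>s\<close> extends in this way.\<close>

lemma bij_betw_prefixes:
  assumes p: "p \<in> permutations_of_set {1..k}" "last p = 1" "k \<ge> 1"
    and B: "finite B" "\<forall>x \<in> B. m < x"
  shows "bij_betw (\<lambda>s. s @ m # arrange (B - set s))
    (\<Union>S \<in> Pow B. prefixes p m S) (avoiding_perms p q (insert m B))"
proof -
  have len: "length p = k" using length_finite_permutations_of_set[OF p(1)] by simp
  have iff: "s @ m # t \<in> avoiding_perms p q (insert m B) \<longleftrightarrow>
      set s \<subseteq> B \<and> s \<in> prefixes p m (set s) \<and> t = arrange (B - set s)" (is "?l \<longleftrightarrow> ?r") for s t
  proof
    assume l: ?l
    then have d: "distinct (s @ m # t)" and eq: "insert m B = insert m (set s \<union> set t)"
      by (auto simp: avoiding_perms_def permutations_of_set_def)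
    \<comment> \<open>\<open>m\<close> belongs neither to \<open>B\<close> nor to the words around
      it, so it cancels from \<open>eq\<close>.\<close>
    have Bst: "B = set s \<union> set t" using eq d B(2) by (auto dest: bspec)
    then have t: "set t = B - set s" using d by auto
    have m: "\<forall>x \<in> set s \<union> set t. m < x" using B(2) Bst by blast
    have av: "avoids_gpattern s q" "sorted_wrt R t"
      using avoids_append_least[OF d m] l by (auto simp: avoiding_perms_def)
    have "begins_with (s @ m # t) p" using l by (simp add: avoiding_perms_def)
    then have "s \<in> prefixes p m (set s)"
      using av d unfolding begins_with_append_least[OF p m]
      by (simp add: prefixes_def len permutations_of_set_def)
    moreover have "t = arrange (B - set s)"
      using arrange_unique[OF _ av(2)] d t by simp
    ultimately show ?r using Bst by blast
  next
    assume r: ?r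
    have fin: "finite (B - set s)" using B by simp
    note arr = arrange[OF fin]
    have d: "distinct (s @ m # t)" and m: "\<forall>x \<in> set s \<union> set t. m < x"
      using r arr B(2) by (auto simp: prefixes_def permutations_of_set_def)
    have "avoids_gpattern (s @ m # t) q"
      using avoids_append_least[OF d m] r arr by (auto simp: prefixes_def)
    moreover have "begins_with (s @ m # t) p"
      unfolding begins_with_append_least[OF p m] using r by (simp add: prefixes_def len)
    moreover have "set (s @ m # t) = insert m B" using r arr by auto
    ultimately show ?l
      using d by (simp only: avoiding_perms_def mem_Collect_eq permutations_of_set_def)
  qed
  have "inj_on (\<lambda>s. s @ m # arrange (B - set s)) (\<Union>S \<in> Pow B. prefixes p m S)"
  proof (rule inj_onI)
    fix s s' assume "s \<in> (\<Union>S \<in> Pow B. prefixes p m S)" "s' \<in> (\<Union>S \<in> Pow B. prefixes p m S)"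
      and eq: "s @ m # arrange (B - set s) = s' @ m # arrange (B - set s')"
    then have "m \<notin> set s" "m \<notin> set s'"
      using B(2) by (auto simp: prefixes_def permutations_of_set_def)
    \<comment> \<open>Since \<open>m\<close> does not occur in the prefix, the prefix is recovered
      as everything before the first \<open>m\<close>.\<close>
    moreover have "takeWhile (\<lambda>x. x \<noteq> m) (r @ m # t) = r" if "m \<notin> set r" for r t
      using that by (induction r) auto
    ultimately show "s = s'" using eq by metis
  qed
  moreover have "(\<lambda>s. s @ m # arrange (B - set s)) ` (\<Union>S \<in> Pow B. prefixes p m S) =
      avoiding_perms p q (insert m B)"
  proof (intro equalityI subsetI)
    fix \<pi> assume "\<pi> \<in> (\<lambda>s. s @ m # arrange (B - set s)) ` (\<Union>S \<in> Pow B. prefixes p m S)"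
    then show "\<pi> \<in> avoiding_perms p q (insert m B)"
      by (auto simp: iff prefixes_def permutations_of_set_def)
  next
    fix \<pi> assume \<pi>: "\<pi> \<in> avoiding_perms p q (insert m B)"
    then have "m \<in> set \<pi>" by (simp add: avoiding_perms_def permutations_of_set_def)
    then obtain s t where "\<pi> = s @ m # t" by (meson split_list)
    then show "\<pi> \<in> (\<lambda>s. s @ m # arrange (B - set s)) ` (\<Union>S \<in> Pow B. prefixes p m S)"
      using \<pi> iff[of s t] by blast
  qed
  ultimately show ?thesis by (simp add: bij_betw_def)
qed

text \<open>For \<open>card S \<ge> k\<close> a prefix has to begin with \<open>p\<close> itself.
  For \<open>card S = k - 1\<close> there is exactly one prefix, the one whose extension by
  \<open>m\<close> is order isomorphic to \<open>p\<close>; if \<open>k = 1\<close> it is the empty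
  word, already counted by \<open>num_avoiding p q 0\<close>, so the extra 1 appears only for
  \<open>k \<ge> 2\<close>.\<close>

lemma card_prefixes:
  assumes p: "p \<in> permutations_of_set {1..k}" "last p = 1" "k \<ge> 1" "avoids_gpattern p q"
    and S: "finite S" "\<forall>x \<in> S. m < x"
  shows "card (prefixes p m S) =
    num_avoiding p q (card S) + (if k \<ge> 2 \<and> card S = k - 1 then 1 else 0)"
proof -
  have len: "length p = k" using length_finite_permutations_of_set[OF p(1)] by simp
  have lens: "length s = card S" if "s \<in> permutations_of_set S" for s
    using that by (rule length_finite_permutations_of_set)
  consider "k \<le> card S" | "card S + 1 = k" | "card S + 1 < k" by linarith
  then show ?thesis
  proof cases
    case 1
    have "begins_with s p \<longleftrightarrow>
        length p \<le> length s \<and> order_isomorphic (take (length p) s) p \<or>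
        length s + 1 = length p \<and> order_isomorphic (s @ [m]) p"
      if "s \<in> permutations_of_set S" for s
    proof -
      have "s \<noteq> []" "length s + 1 \<noteq> length p" using lens[OF that] 1 p(3) len by auto
      then show ?thesis by (simp add: begins_with_def)
    qed
    then have "prefixes p m S = avoiding_perms p q S"
      unfolding prefixes_def avoiding_perms_def by blast
    moreover have "card S \<noteq> k - 1" using 1 p(3) by linarith
    ultimately show ?thesis using card_avoiding_perms[OF S(1)] by simp
  next
    case 2
    have mS: "m \<notin> S" using S(2) by blast
    \<comment> \<open>Taking \<open>t\<close> empty in \<open>avoids_append_least\<close> passes
      avoidance from \<open>s @ [m]\<close> down to \<open>s\<close>.\<close>
    have avoids: "avoids_gpattern s q"
      if "s \<in> permutations_of_set S" "order_isomorphic (s @ [m]) p" for s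
    proof -
      have d: "distinct (s @ m # [])" "\<forall>x \<in> set s \<union> set []. m < x"
        using that(1) mS S(2) by (auto simp: permutations_of_set_def)
      have "avoids_gpattern (s @ m # []) q"
        using contains_gpattern_cong[OF that(2)] p(4) by (simp add: avoids_gpattern_def)
      then show ?thesis using avoids_append_least[OF d] by simp
    qed
    have "card (insert m S) = k" using 2 S(1) mS by simp
    then obtain \<pi> where \<pi>: "\<pi> \<in> permutations_of_set (insert m S)" "order_isomorphic \<pi> p"
      and unique: "\<And>\<pi>'. \<pi>' \<in> permutations_of_set (insert m S) \<Longrightarrow> order_isomorphic \<pi>' p \<Longrightarrow> \<pi>' = \<pi>"
      using ex1_order_isomorphic_perm[OF p(1), of "insert m S"] S(1) by blast
    have "m \<in> set \<pi>" using \<pi>(1) by (simp add: permutations_of_set_def)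
    then obtain s t where st: "\<pi> = s @ m # t" by (meson split_list)
    have d: "distinct (s @ m # t)" "insert m S = insert m (set s \<union> set t)"
      using \<pi>(1) by (auto simp: permutations_of_set_def st)
    have Sst: "S = set s \<union> set t" using d mS by auto
    have "length \<pi> = k" using \<pi>(2) len order_isomorphic_length by simp
    then have "begins_with \<pi> p" using \<pi>(2) by (simp add: begins_with_def len)
    moreover have "length s + 1 \<le> k" using \<open>length \<pi> = k\<close> st by simp
    \<comment> \<open>Either way of beginning with \<open>p\<close> needs at least
      \<open>k - 1\<close> letters before \<open>m\<close>, so \<open>m\<close> is the last letter
      of \<pi>.\<close>
    ultimately have "length s + 1 = k"
      using begins_with_append_least[OF p(1-3), of s t m] S(2) Sst st by auto
    moreover have "length \<pi> = length s + 1 + length t" using st by simp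
    ultimately have "t = []" using \<open>length \<pi> = k\<close> by (metis add_left_cancel add_0_right length_0_conv)
    then have s: "s \<in> permutations_of_set S" "\<pi> = s @ [m]"
      using st d Sst by (auto simp: permutations_of_set_def)
    have "prefixes p m S = {s}"
    proof (intro equalityI subsetI)
      fix s' assume s': "s' \<in> prefixes p m S"
      then have "s' @ [m] \<in> permutations_of_set (insert m S)" "order_isomorphic (s' @ [m]) p"
        using lens[of s'] 2 mS by (auto simp: prefixes_def permutations_of_set_def len)
      then show "s' \<in> {s}" using unique s(2) by blast
    next
      fix s' assume "s' \<in> {s}"
      then show "s' \<in> prefixes p m S"
        using s \<pi>(2) avoids[of s] lens[of s] 2 by (simp add: prefixes_def len)
    qed
    moreover have "num_avoiding p q (card S) = (if k \<ge> 2 then 0 else 1)"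
    proof (cases "k \<ge> 2")
      case True
      then show ?thesis using num_avoiding_eq_0[of _ p] len 2 by simp
    next
      case False
      then have "card S = 0" using 2 by linarith
      then show ?thesis using num_avoiding_at_0[OF p(1,3)] by simp
    qed
    moreover have "card S = k - 1" using 2 by linarith
    ultimately show ?thesis by (cases "k \<ge> 2") simp_all
  next
    case 3
    then have "prefixes p m S = {}" using lens len by (fastforce simp: prefixes_def)
    then show ?thesis using 3 num_avoiding_eq_0[of _ p] len by simp
  qed
qed

text \<open>Permutations are grouped by the set \<open>S\<close> of letters before the least one;
  the number of prefixes depends only on \<open>card S\<close>, whence the binomial
  coefficients.\<close>

lemma num_avoiding_Suc:
  assumes p: "p \<in> permutations_of_set {1..k}" "last p = 1" "k \<ge> 1" "avoids_gpattern p q"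
  shows "num_avoiding p q (Suc n) = (\<Sum>i\<le>n. (n choose i) *
    (num_avoiding p q i + (if k \<ge> 2 \<and> i = k - 1 then 1 else 0)))"
proof -
  let ?f = "\<lambda>i. num_avoiding p q i + (if k \<ge> 2 \<and> i = k - 1 then 1 else 0)"
  have pos: "\<forall>x \<in> {1..n}. 0 < x" by auto
  \<comment> \<open>With 0 as the least letter, the remaining ones are exactly
    \<open>{1..n}\<close>.\<close>
  have "num_avoiding p q (Suc n) = card (avoiding_perms p q (insert 0 {1..n}))"
    by (subst card_avoiding_perms) auto
  also have "\<dots> = card (\<Union>S \<in> Pow {1..n}. prefixes p 0 S)"
    using bij_betw_prefixes[OF p(1-3) _ pos] by (simp add: bij_betw_same_card)
  also have "\<dots> = (\<Sum>S \<in> Pow {1..n}. card (prefixes p 0 S))"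
    by (rule card_UN_disjoint) (auto simp: prefixes_def permutations_of_set_def
        intro: finite_subset[OF _ finite_permutations_of_set] dest: finite_subset)
  also have "\<dots> = (\<Sum>S \<in> Pow {1..n}. ?f (card S))"
    by (intro sum.cong refl card_prefixes[OF p]) (auto dest: finite_subset)
  also have "\<dots> = (\<Sum>i\<le>n. \<Sum>S \<in> {S \<in> Pow {1..n}. card S = i}. ?f (card S))"
    by (intro sum.group[symmetric]) (auto dest: card_mono[rotated])
  also have "\<dots> = (\<Sum>i\<le>n. (n choose i) * ?f i)"
    using n_subsets[of "{1..n}"] by (intro sum.cong) auto
  finally show ?thesis .
qed

end

section \<open>Complementation of permutations and patterns\<close>

text \<open>Complementing reverses every comparison, on both sides at once. The bounds keep the
  subtraction of natural numbers from truncating.\<close>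

lemma order_isomorphic_complement:
  assumes "set xs \<subseteq> {..M}" "set ys \<subseteq> {..N}"
  shows "order_isomorphic (map (\<lambda>x. M + 1 - x) xs) (map (\<lambda>y. N + 1 - y) ys) \<longleftrightarrow>
    order_isomorphic xs ys"
proof -
  have flip: "map (\<lambda>z. L + 1 - z) zs ! i < map (\<lambda>z. L + 1 - z) zs ! j \<longleftrightarrow> zs ! j < zs ! i"
    if "set zs \<subseteq> {..L}" "i < length zs" "j < length zs" for L :: nat and zs i j
  proof -
    have "zs ! i \<le> L" "zs ! j \<le> L" using that nth_mem by blast+
    then show ?thesis using that by auto
  qed
  show ?thesis
    using flip[OF assms(1)] flip[OF assms(2)] by (auto simp: order_isomorphic_def)
qed

lemma contains_gpattern_complement:
  assumes "set \<pi> \<subseteq> {..n}" "length q = 3" "set q \<subseteq> {..3}"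
  shows "contains_gpattern (map (\<lambda>x. n + 1 - x) \<pi>) (perm_complement q) \<longleftrightarrow> contains_gpattern \<pi> q"
proof -
  let ?f = "\<lambda>x. n + 1 - x"
  have "order_isomorphic [map ?f \<pi> ! i, map ?f \<pi> ! j, map ?f \<pi> ! (j + 1)] (perm_complement q) \<longleftrightarrow>
      order_isomorphic [\<pi> ! i, \<pi> ! j, \<pi> ! (j + 1)] q" if "i < j" "j + 1 < length \<pi>" for i j
  proof -
    have "\<pi> ! i \<in> set \<pi>" "\<pi> ! j \<in> set \<pi>" "\<pi> ! (j + 1) \<in> set \<pi>" using that by simp_all
    then have "set [\<pi> ! i, \<pi> ! j, \<pi> ! (j + 1)] \<subseteq> {..n}" using assms(1) by auto
    from order_isomorphic_complement[OF this assms(3)] show ?thesis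
      using that assms(2) by (simp add: perm_complement_def)
  qed
  then have "i < j \<and> j + 1 < length \<pi> \<and>
        order_isomorphic [map ?f \<pi> ! i, map ?f \<pi> ! j, map ?f \<pi> ! (j + 1)] (perm_complement q) \<longleftrightarrow>
      i < j \<and> j + 1 < length \<pi> \<and> order_isomorphic [\<pi> ! i, \<pi> ! j, \<pi> ! (j + 1)] q" for i j
    by blast
  then show ?thesis unfolding contains_gpattern_def length_map by simp
qed

lemma begins_with_complement:
  assumes "set \<pi> \<subseteq> {..n}" "set p \<subseteq> {..length p}"
  shows "begins_with (map (\<lambda>x. n + 1 - x) \<pi>) (perm_complement p) \<longleftrightarrow> begins_with \<pi> p"
proof -
  have "set (take (length p) \<pi>) \<subseteq> {..n}" using assms(1) set_take_subset[of "length p" \<pi>] by blast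
  from order_isomorphic_complement[OF this assms(2)]
  have "order_isomorphic (take (length p) (map (\<lambda>x. n + 1 - x) \<pi>)) (perm_complement p) \<longleftrightarrow>
      order_isomorphic (take (length p) \<pi>) p"
    by (simp add: perm_complement_def take_map)
  \<comment> \<open>The convention for the empty permutation singles out \<open>[1]\<close>, which
    is its own complement.\<close>
  moreover have "perm_complement p = [1] \<longleftrightarrow> p = [1]"
    using assms(2) by (auto simp: perm_complement_def map_eq_Cons_conv)
  ultimately show ?thesis by (simp add: begins_with_def perm_complement_def)
qed

lemma num_avoiding_complement:
  assumes "set p \<subseteq> {..length p}" "length q = 3" "set q \<subseteq> {..3}"
  shows "num_avoiding (perm_complement p) (perm_complement q) n = num_avoiding p q n"
proof -
  let ?f = "\<lambda>x. n + 1 - x"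
  have bij: "bij_betw ?f {1..n} {1..n}" by (rule bij_betwI[where g = ?f]) auto
  then have perms: "permutations_of_set {1..n} = map ?f ` permutations_of_set {1..n}"
    using permutations_of_set_image_inj[of ?f "{1..n}"] by (simp add: bij_betw_def)
  have le: "set \<pi> \<subseteq> {..n}" if "\<pi> \<in> permutations_of_set {1..n}" for \<pi>
    using that by (auto simp: permutations_of_set_def)
  let ?P = "\<lambda>\<pi>. avoids_gpattern \<pi> q \<and> begins_with \<pi> p"
  let ?P' = "\<lambda>\<pi>. avoids_gpattern \<pi> (perm_complement q) \<and> begins_with \<pi> (perm_complement p)"
  have P: "?P' (map ?f \<pi>) \<longleftrightarrow> ?P \<pi>" if "\<pi> \<in> permutations_of_set {1..n}" for \<pi>
    using contains_gpattern_complement[OF le[OF that] assms(2,3)]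
      begins_with_complement[OF le[OF that] assms(1)] by (simp add: avoids_gpattern_def)
  have "{\<pi> \<in> permutations_of_set {1..n}. ?P' \<pi>} = {\<pi> \<in> map ?f ` permutations_of_set {1..n}. ?P' \<pi>}"
    using perms by simp
  also have "\<dots> = map ?f ` {\<pi> \<in> permutations_of_set {1..n}. ?P \<pi>}" using P by blast
  finally have "{\<pi> \<in> permutations_of_set {1..n}. ?P' \<pi>} =
    map ?f ` {\<pi> \<in> permutations_of_set {1..n}. ?P \<pi>}" .
  moreover have "inj_on (map ?f) {\<pi> \<in> permutations_of_set {1..n}. ?P \<pi>}"
    using bij unfolding bij_betw_def
    by (intro inj_on_mapI) (auto simp: permutations_of_set_def elim!: inj_on_subset)
  ultimately show ?thesis by (simp add: card_image num_avoiding_def)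
qed

section \<open>Convergence and the linear differential equation\<close>

text \<open>Keeps the coefficients of the exponential generating function at most 1, on which its
  convergence rests.\<close>

lemma num_avoiding_le_fact: "num_avoiding p q n \<le> fact n"
proof -
  have "num_avoiding p q n \<le> card (permutations_of_set {1..n})"
    unfolding num_avoiding_def by (intro card_mono) auto
  then show ?thesis by simp
qed

text \<open>Comparison with the geometric series. It allows the series to be evaluated and
  differentiated as a function for arguments of modulus below 1.\<close>

lemma fps_conv_radius_ge_1:
  fixes F :: "real fps"
  assumes "\<And>n. \<bar>fps_nth F n\<bar> \<le> 1"
  shows "fps_conv_radius F \<ge> 1"
  unfolding fps_conv_radius_def
proof (rule conv_radius_geI_ex')
  fix r :: real assume "0 < r" "ereal r < 1"
  then have geom: "summable (\<lambda>n. r ^ n)" by (intro summable_geometric) auto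
  have "norm (fps_nth F n * of_real r ^ n) \<le> r ^ n" for n
    using mult_right_mono[OF assms[of n], of "r ^ n"] \<open>0 < r\<close> by (simp add: abs_mult)
  then show "summable (\<lambda>n. fps_nth F n * of_real r ^ n)"
    by (rule summable_comparison_test'[OF geom, where N = 0])
qed

text \<open>The integrating factor \<open>exp (- exp x)\<close> turns the differential equation
  \<open>F' = e\<^sup>x (F + a x\<^sup>m)\<close> into a plain integration.\<close>

lemma has_fps_expansion_of_fps_deriv:
  fixes F :: "real fps"
  assumes radius: "fps_conv_radius F \<ge> 1"
    and ode: "fps_deriv F = fps_exp 1 * (F + fps_const a * fps_X ^ m)"
  shows "(\<lambda>x. exp (exp x) *
      (fps_nth F 0 * exp (- 1) + a * (LBINT t=0..ereal x. t ^ m * exp (- exp t + t))))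
    has_fps_expansion F"
proof -
  have eval: "eval_fps F x = exp (exp x) *
      (fps_nth F 0 * exp (- 1) + a * (LBINT t=0..ereal x. t ^ m * exp (- exp t + t)))"
    if x: "\<bar>x\<bar> < 1" for x
  proof -
    \<comment> \<open>\<open>?G\<close> is the series times the integrating factor. In its
      derivative the term \<open>exp y * eval_fps F y\<close> from the equation cancels against the
      derivative of the factor, leaving \<open>?g\<close>.\<close>
    let ?G = "\<lambda>y. eval_fps F y * exp (- exp y)" and ?g = "\<lambda>t. a * (t ^ m * exp (- exp t + t))"
    have deriv: "(?G has_real_derivative ?g y) (at y)" if "\<bar>y\<bar> < 1" for y
    proof -
      have F: "norm y < fps_conv_radius F"
        using that less_le_trans[OF _ radius, of "ereal (norm y)"] by simp
      have H: "norm y < fps_conv_radius (fps_const a * fps_X ^ m)"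
        by (rule less_le_trans[OF _ fps_conv_radius_mult]) simp
      have FH: "norm y < fps_conv_radius (F + fps_const a * fps_X ^ m)"
        using F H by (simp add: less_le_trans[OF _ fps_conv_radius_add])
      have "eval_fps (fps_deriv F) y = exp y * (eval_fps F y + a * y ^ m)"
        unfolding ode using F H FH by (simp add: eval_fps_mult eval_fps_add)
      then have "(eval_fps F has_real_derivative exp y * (eval_fps F y + a * y ^ m)) (at y)"
        using has_field_derivative_eval_fps[OF F] by simp
      then show ?thesis unfolding exp_add
        by (auto intro!: derivative_eq_intros simp: algebra_simps)
    qed
    \<comment> \<open>\<open>min\<close> and \<open>max\<close> admit negative \<open>x\<close>: the
      segment between 0 and \<open>x\<close> stays inside the disc of convergence.\<close>
    have abs_less: "\<bar>y\<bar> < 1" if "min 0 x \<le> y" "y \<le> max 0 x" for y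
      using that x by (auto simp: min_def max_def split: if_splits)
    have "(LBINT t=ereal 0..ereal x. ?g t) = ?G x - ?G 0"
    proof (rule interval_integral_FTC_finite)
      fix y assume "min 0 x \<le> y" "y \<le> max 0 x"
      then have "(?G has_real_derivative ?g y) (at y)" by (intro deriv abs_less)
      then show "(?G has_vector_derivative ?g y) (at y within {min 0 x..max 0 x})"
        by (simp add: has_real_derivative_iff_has_vector_derivative has_vector_derivative_at_within)
    qed (intro continuous_intros)
    then have "eval_fps F x * exp (- exp x) =
        fps_nth F 0 * exp (- 1) + a * (LBINT t=0..ereal x. t ^ m * exp (- exp t + t))"
      by (simp add: eval_fps_at_0 zero_ereal_def)
    then show ?thesis by (simp add: exp_minus field_simps)
  qed
  \<comment> \<open>Besides a positive radius of convergence, an expansion at 0 requires agreement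
    only near 0.\<close>
  have "eventually (\<lambda>x::real. \<bar>x\<bar> < 1) (nhds 0)"
    using eventually_nhds_in_open[of "ball 0 1" "0::real"] by (simp add: dist_norm)
  then have "eventually (\<lambda>x. eval_fps F x = exp (exp x) *
      (fps_nth F 0 * exp (- 1) + a * (LBINT t=0..ereal x. t ^ m * exp (- exp t + t)))) (nhds 0)"
    by eventually_elim (rule eval)
  moreover have "fps_conv_radius F > 0" using radius by (rule less_le_trans[rotated]) simp
  ultimately show ?thesis by (simp add: has_fps_expansion_def)
qed

section \<open>The exponential generating function and its closed form\<close>

context least_gpattern
begin

text \<open>The recursion and its initial value depend on \<open>k\<close> alone, neither on the
  choice between the two patterns nor on the word \<open>p\<close>.\<close>

lemma num_avoiding_eq:
  assumes "least_gpattern q' R'"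
    and p: "p \<in> permutations_of_set {1..k}" "last p = 1" "k \<ge> 1" "avoids_gpattern p q"
    and p': "p' \<in> permutations_of_set {1..k}" "last p' = 1" "avoids_gpattern p' q'"
  shows "num_avoiding p q n = num_avoiding p' q' n"
proof (induction n rule: less_induct)
  case (less n)
  interpret q': least_gpattern q' R' by fact
  show ?case
  proof (cases n)
    case 0
    then show ?thesis
      using num_avoiding_at_0[OF p(1,3)] num_avoiding_at_0[OF p'(1) p(3)] by simp
  next
    case (Suc m)
    then show ?thesis
      unfolding Suc num_avoiding_Suc[OF p] q'.num_avoiding_Suc[OF p'(1,2) p(3) p'(3)]
      using less.IH Suc by (intro sum.cong) auto
  qed
qed

text \<open>Dividing the recursion by \<open>fact n\<close> turns its binomial sum into a
  coefficient of a product with the exponential series; the extra 1 at \<open>i = k - 1\<close>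
  becomes the monomial.\<close>

lemma fps_deriv_egf_avoiding:
  assumes p: "p \<in> permutations_of_set {1..k}" "last p = 1" "k \<ge> 1" "avoids_gpattern p q"
  shows "fps_deriv (egf_avoiding p q) = fps_exp 1 * (egf_avoiding p q +
    fps_const (if k \<ge> 2 then 1 / fact (k - 1) else 0) * fps_X ^ (k - 1))"
proof (rule fps_ext)
  fix n
  let ?f = "\<lambda>i. num_avoiding p q i + (if k \<ge> 2 \<and> i = k - 1 then 1 else 0)"
  let ?G = "egf_avoiding p q + fps_const (if k \<ge> 2 then 1 / fact (k - 1) else 0) * fps_X ^ (k - 1)"
  have G: "fps_nth ?G i = real (?f i) / fact i" for i
    by (simp add: egf_avoiding_def add_divide_distrib)
  have "fps_nth (fps_deriv (egf_avoiding p q)) n = real (num_avoiding p q (Suc n)) / fact n"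
    by (simp add: egf_avoiding_def field_simps del: of_nat_Suc)
  also have "\<dots> = (\<Sum>i\<le>n. real (n choose i) * real (?f i) / fact n)"
    unfolding num_avoiding_Suc[OF p] of_nat_sum of_nat_mult sum_divide_distrib ..
  also have "\<dots> = (\<Sum>i\<le>n. fps_nth ?G i * fps_nth (fps_exp 1) (n - i))"
    unfolding G by (intro sum.cong refl) (simp add: binomial_fact)
  also have "\<dots> = fps_nth (fps_exp 1 * ?G) n"
    by (simp add: mult.commute[of "fps_exp 1"] fps_mult_nth atLeast0AtMost)
  finally show "fps_nth (fps_deriv (egf_avoiding p q)) n = fps_nth (fps_exp 1 * ?G) n" .
qed

text \<open>For \<open>k \<ge> 2\<close> the constant term vanishes and only the integral remains;
  for \<open>k = 1\<close> the inhomogeneous term vanishes and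
  \<open>exp (exp x) * exp (- 1)\<close> remains.\<close>

lemma egf_avoiding_expansion:
  assumes p: "p \<in> permutations_of_set {1..k}" "last p = 1" "k \<ge> 1" "avoids_gpattern p q"
  shows "(\<lambda>x::real. if k \<ge> 2
      then exp (exp x) / fact (k - 1) * (LBINT t=0..ereal x. t ^ (k - 1) * exp (- exp t + t))
      else exp (exp x - 1)) has_fps_expansion egf_avoiding p q"
proof -
  have "\<bar>fps_nth (egf_avoiding p q) n\<bar> \<le> 1" for n
  proof -
    have "real (num_avoiding p q n) \<le> fact n"
      using num_avoiding_le_fact[of p q n] by (metis of_nat_fact of_nat_le_iff)
    then show ?thesis by (simp add: egf_avoiding_def)
  qed
  note expansion = has_fps_expansion_of_fps_deriv[OF fps_conv_radius_ge_1[OF this]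
      fps_deriv_egf_avoiding[OF p]]
  have "fps_nth (egf_avoiding p q) 0 = (if k \<ge> 2 then 0 else 1)"
    using num_avoiding_at_0[OF p(1,3)] by (simp add: egf_avoiding_def)
  then show ?thesis using expansion by (cases "k \<ge> 2") (simp_all add: exp_diff exp_minus field_simps)
qed

end

text \<open>The closed form is asserted as an expansion at 0, since \<open>egf_avoiding\<close> is a
  formal series while the integral defines a function; the chain of equalities carries it over to
  all four series.\<close>

theorem theorem28:
  fixes k :: nat and p1 p2 :: "nat list"
  assumes "k \<ge> 1"
    and "p1 \<in> permutations_of_set {1..k}" and "last p1 = 1" and "avoids_gpattern p1 [1, 2, 3]"
    and "p2 \<in> permutations_of_set {1..k}" and "last p2 = 1" and "avoids_gpattern p2 [1, 3, 2]"
  shows "last (perm_complement p1) = k \<and> avoids_gpattern (perm_complement p1) [3, 2, 1] \<and>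
     last (perm_complement p2) = k \<and> avoids_gpattern (perm_complement p2) [3, 1, 2] \<and>
     egf_avoiding p1 [1, 2, 3] = egf_avoiding (perm_complement p1) [3, 2, 1] \<and>
     egf_avoiding (perm_complement p1) [3, 2, 1] = egf_avoiding p2 [1, 3, 2] \<and>
     egf_avoiding p2 [1, 3, 2] = egf_avoiding (perm_complement p2) [3, 1, 2] \<and>
     ((\<lambda>x::real. if k \<ge> 2
            then exp (exp x) / fact (k - 1) * (LBINT t=0..ereal x. t ^ (k - 1) * exp (- exp t + t))
            else exp (exp x - 1))
          has_fps_expansion egf_avoiding (perm_complement p2) [3, 1, 2])"
proof -
  interpret q123: least_gpattern "[1, 2, 3]" "(\<ge>)" by unfold_locales simp
  interpret q132: least_gpattern "[1, 3, 2]" "(\<le>)" by unfold_locales simp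
  have q: "perm_complement [1, 2, 3] = [3, 2, 1]" "perm_complement [1, 3, 2] = [3, 1, 2]"
    by (simp_all add: perm_complement_def)
  have complement: "last (perm_complement p) = k \<and> avoids_gpattern (perm_complement p) (perm_complement q) \<and>
      egf_avoiding (perm_complement p) (perm_complement q) = egf_avoiding p q"
    if p: "p \<in> permutations_of_set {1..k}" "last p = 1" "avoids_gpattern p q"
      and q: "length q = 3" "set q \<subseteq> {..3}" for p q
  proof -
    have len: "length p = k" using length_finite_permutations_of_set[OF p(1)] by simp
    have "set p = {1..k}" using p(1) by (simp add: permutations_of_set_def)
    then have le: "set p \<subseteq> {..length p}" using len by auto
    have "p \<noteq> []" using len \<open>k \<ge> 1\<close> by auto
    then have "last (perm_complement p) = k"
      using p(2) len by (simp add: perm_complement_def last_map)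
    moreover have "avoids_gpattern (perm_complement p) (perm_complement q)"
      using contains_gpattern_complement[OF le q] p(3)
      by (simp add: avoids_gpattern_def perm_complement_def)
    moreover have "egf_avoiding (perm_complement p) (perm_complement q) = egf_avoiding p q"
      unfolding egf_avoiding_def num_avoiding_complement[OF le q] ..
    ultimately show ?thesis by blast
  qed
  note c1 = complement[OF assms(2-4), unfolded q(1)] and c2 = complement[OF assms(5-7), unfolded q(2)]
  have "egf_avoiding p1 [1, 2, 3] = egf_avoiding p2 [1, 3, 2]"
    using q123.num_avoiding_eq[OF q132.least_gpattern_axioms assms(2,3,1,4,5-7)]
    by (simp add: egf_avoiding_def)
  then show ?thesis
    using c1 c2 q132.egf_avoiding_expansion[OF assms(5,6,1,7)] by simp
qed

end
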